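(* Let $C$ be a conjugation on a separable complex Hilbert space $\mathcal{H}$, and let $T$ be a bounded linear operator on $\mathcal{H}$ with $T=A+iB$, where $A$ is a $C$-symmetric and $B$ a $C$-skew-symmetric bounded linear operator on $\mathcal{H}$. Then the following are equivalent: (1) $T$ is $C$-normal; (2) $\|Tx\|^2=\|Ax\|^2+\|Bx\|^2$ for all $x\in\mathcal{H}$; (3) $A^*B=B^*A$; (4) $AB^*=BA^*$. In this case, $T^*T=A^*A+B^*B$ and $TT^*=AA^*+BB^*$, with $(A^*A)(B^*B)=(B^*B)(A^*A)$, and $$\max\{\|A\|^2,\|B\|^2\}\le\|T\|^2\le\|A\|^2+\|B\|^2.$$
   Context: A conjugation on $\mathcal{H}$ is an anti-linear map $C:\mathcal{H}\to\mathcal{H}$ with $C^2=I$ and $\langle Cx,Cy\rangle=\langle y,x\rangle$ for all $x,y$. A bounded linear operator $X$ is $C$-symmetric if $CXC=X^*$, $C$-skew-symmetric if $CX^*C=-X$, and $C$-normal if $C|X|C=|X^*|$ (equivalently $CX^*XC=XX^*$), where $|X|=(X^*X)^{1/2}$. *)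

theory Defs
  imports "HOL-Analysis.Analysis"
begin

(* The real inner product inherited from real_inner is the real part of the complex one.
   Since \<langle>x, x\<rangle> is real by conjugate symmetry, positive definiteness and
   norm x = sqrt \<langle>x, x\<rangle> are inherited from real_inner. The complex inner product is
   linear in its first argument. *)
class complex_inner = real_inner +
  fixes scaleC :: "complex \<Rightarrow> 'a \<Rightarrow> 'a" (infixr \<open>*\<^sub>C\<close> 75)
    and cinner :: "'a \<Rightarrow> 'a \<Rightarrow> complex" (\<open>\<langle>_,/ _\<rangle>\<close>)
  assumes scaleC_add_right: "c *\<^sub>C (x + y) = c *\<^sub>C x + c *\<^sub>C y"
    and scaleC_add_left: "(c + d) *\<^sub>C x = c *\<^sub>C x + d *\<^sub>C x"
    and scaleC_scaleC: "c *\<^sub>C (d *\<^sub>C x) = (c * d) *\<^sub>C x"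
    and scaleR_scaleC: "r *\<^sub>R x = complex_of_real r *\<^sub>C x"
    and cinner_commute: "\<langle>x, y\<rangle> = cnj \<langle>y, x\<rangle>"
    and cinner_add_left: "\<langle>x + y, z\<rangle> = \<langle>x, z\<rangle> + \<langle>y, z\<rangle>"
    and cinner_scaleC_left: "\<langle>c *\<^sub>C x, y\<rangle> = c * \<langle>x, y\<rangle>"
    and inner_eq_Re_cinner: "x \<bullet> y = Re \<langle>x, y\<rangle>"

class complex_hilbert = complex_inner + complete_space

definition bounded_clinear :: "('a::complex_inner \<Rightarrow> 'a) \<Rightarrow> bool" where
  "bounded_clinear X \<longleftrightarrow> bounded_linear X \<and> (\<forall>c x. X (c *\<^sub>C x) = c *\<^sub>C X x)"

(* The description is proper for bounded X on a Hilbert space, by Riesz representation. *)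
definition cadjoint :: "('a::complex_inner \<Rightarrow> 'a) \<Rightarrow> 'a \<Rightarrow> 'a" where
  "cadjoint X = (THE Y. \<forall>x y. \<langle>X x, y\<rangle> = \<langle>x, Y y\<rangle>)"

definition positive_op :: "('a::complex_inner \<Rightarrow> 'a) \<Rightarrow> bool" where
  "positive_op S \<longleftrightarrow> bounded_clinear S \<and> (\<forall>x. \<langle>S x, x\<rangle> \<in> \<real>\<^sub>\<ge>\<^sub>0)"

(* |X| is the unique positive square root of X* X. *)
definition op_abs :: "('a::complex_inner \<Rightarrow> 'a) \<Rightarrow> 'a \<Rightarrow> 'a" where
  "op_abs X = (THE S. positive_op S \<and> S \<circ> S = cadjoint X \<circ> X)"

definition conjugation :: "('a::complex_inner \<Rightarrow> 'a) \<Rightarrow> bool" where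
  "conjugation C \<longleftrightarrow>
     (\<forall>x y. C (x + y) = C x + C y) \<and> (\<forall>c x. C (c *\<^sub>C x) = cnj c *\<^sub>C C x) \<and>
     C \<circ> C = id \<and> (\<forall>x y. \<langle>C x, C y\<rangle> = \<langle>y, x\<rangle>)"

definition C_symmetric :: "('a::complex_inner \<Rightarrow> 'a) \<Rightarrow> ('a \<Rightarrow> 'a) \<Rightarrow> bool" where
  "C_symmetric C X \<longleftrightarrow> C \<circ> X \<circ> C = cadjoint X"

definition C_skew_symmetric :: "('a::complex_inner \<Rightarrow> 'a) \<Rightarrow> ('a \<Rightarrow> 'a) \<Rightarrow> bool" where
  "C_skew_symmetric C X \<longleftrightarrow> C \<circ> cadjoint X \<circ> C = (\<lambda>x. - X x)"

definition C_normal :: "('a::complex_inner \<Rightarrow> 'a) \<Rightarrow> ('a \<Rightarrow> 'a) \<Rightarrow> bool" where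
  "C_normal C X \<longleftrightarrow> C \<circ> op_abs X \<circ> C = op_abs (cadjoint X)"

end

theory Submission
  imports Defs
begin

text \<open>
  Everything follows from comparing \<open>T\<^sup>* T\<close> and \<open>T T\<^sup>*\<close> in terms of \<open>A\<close> and \<open>B\<close>. From
  \<open>T\<^sup>* = A\<^sup>* - i B\<^sup>*\<close> one gets
  \<open>T\<^sup>* T = A\<^sup>* A + B\<^sup>* B + i (A\<^sup>* B - B\<^sup>* A)\<close> and
  \<open>T T\<^sup>* = A A\<^sup>* + B B\<^sup>* + i (B A\<^sup>* - A B\<^sup>*)\<close>.
  Moving \<open>C\<close> past an operator turns \<open>A\<close> into \<open>A\<^sup>*\<close> and \<open>B\<close> into \<open>- B\<^sup>*\<close>, and it turns \<open>i\<close> into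
  \<open>- i\<close>; so \<open>C T\<^sup>* T C = A A\<^sup>* + B B\<^sup>* + i (A B\<^sup>* - B A\<^sup>*)\<close>, which equals \<open>T T\<^sup>*\<close> exactly when
  \<open>A B\<^sup>* = B A\<^sup>*\<close>. Conjugating this identity by \<open>C\<close> gives \<open>A\<^sup>* B = B\<^sup>* A\<close>. The latter in turn says that
  the self-adjoint operator \<open>i (A\<^sup>* B - B\<^sup>* A)\<close> vanishes, hence that its quadratic form
  \<open>\<parallel>T x\<parallel>\<^sup>2 - \<parallel>A x\<parallel>\<^sup>2 - \<parallel>B x\<parallel>\<^sup>2\<close> does (\<open>norm_Pythagoras_iff\<close>). When the cross terms
  vanish, the two product formulas are immediate, both \<open>A\<^sup>* A B\<^sup>* B\<close> and \<open>B\<^sup>* B A\<^sup>* A\<close> equal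
  \<open>B\<^sup>* A A\<^sup>* B\<close>, and the norm estimates follow from the Pythagorean identity.

  The link between this computation and \<open>C\<close>-normality is \<open>C_normal_iff\<close>: the condition
  \<open>C |T| C = |T\<^sup>*|\<close> may be squared, because conjugation by \<open>C\<close> preserves positivity and positive square
  roots are unique. This rests on two facts about Hilbert spaces: adjoints exist
  (\<open>adjoint_exists\<close>, from the Riesz representation theorem), and \<open>X\<^sup>* X\<close> has exactly one positive
  square root (\<open>op_abs_ex1\<close>). Both are obtained on the underlying real Hilbert space, where the inner
  product is the real part of the complex one. Complex linearity is recovered by observing that
  it means commuting with multiplication by \<open>i\<close>.
\<close>

section \<open>Bounded operators on a real Hilbert space\<close>

text \<open>The first-order condition at a minimum: along any line a quadratic form changes by
  such an expression. It gives the variational step in the Riesz representation theorem and the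
  kernel of a positive operator.\<close>
lemma linear_coefficient_zero:
  fixes b c :: real
  assumes "\<And>t. 0 \<le> 2 * t * b + t\<^sup>2 * c"
  shows "b = 0"
proof (rule ccontr)
  assume "b \<noteq> 0"
  \<comment> \<open>The step \<open>- b / d\<close> with \<open>d > c\<close> is short enough for the linear term to dominate.\<close>
  define d where "d = \<bar>c\<bar> + 1"
  have d: "d > 0" "c < d" unfolding d_def by auto
  have "0 \<le> 2 * (- b / d) * b + (- b / d)\<^sup>2 * c" by (rule assms)
  also have "\<dots> = (b\<^sup>2 / d) * (c / d - 2)"
    using d by (simp add: field_simps power2_eq_square)
  also have "\<dots> < 0"
    using d \<open>b \<noteq> 0\<close> by (intro mult_pos_neg) (auto simp: field_simps)
  finally show False by simp
qed

text \<open>The representing vector is the minimiser of \<open>\<phi> x = \<parallel>x\<parallel>\<^sup>2 - 2 f x\<close>. By the parallelogram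
  law a minimising sequence is Cauchy, and the first-order condition at its limit \<open>z\<close> reads
  \<open>f y = \<langle>z, y\<rangle>\<close>.\<close>
lemma riesz_representation:
  fixes f :: "'a::{real_inner,banach} \<Rightarrow> real"
  assumes "bounded_linear f"
  obtains z where "\<And>x. f x = x \<bullet> z"
proof -
  interpret f: bounded_linear f by fact
  define \<phi> where "\<phi> x = x \<bullet> x - 2 * f x" for x
  define I where "I = (INF x. \<phi> x)"
  have expand: "\<phi> (x + t *\<^sub>R y) = \<phi> x + 2 * t * (x \<bullet> y - f y) + t\<^sup>2 * (y \<bullet> y)" for x y t
    by (simp add: \<phi>_def f.add f.scaleR inner_add_left inner_add_right inner_commute
        power2_eq_square algebra_simps)
  obtain K where K: "\<And>x. \<bar>f x\<bar> \<le> norm x * K"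
    using f.bounded by auto
  \<comment> \<open>The lower bound comes from completing the square: \<open>\<phi> x \<ge> (\<parallel>x\<parallel> - K)\<^sup>2 - K\<^sup>2\<close>.\<close>
  have "- (K\<^sup>2) \<le> \<phi> x" for x
  proof -
    have "f x \<le> norm x * K" using K[of x] by simp
    moreover have "0 \<le> (norm x - K)\<^sup>2" by simp
    ultimately show ?thesis
      by (simp add: \<phi>_def dot_square_norm power2_diff)
  qed
  then have bdd: "bdd_below (range \<phi>)" by (intro bdd_belowI[of _ "- (K\<^sup>2)"]) auto
  have I_le: "I \<le> \<phi> x" for x
    unfolding I_def using bdd by (auto intro: cINF_lower)
  have "\<exists>x. \<phi> x < I + 1 / real (Suc n)" for n
  proof -
    have "Inf (range \<phi>) < I + 1 / real (Suc n)" by (simp add: I_def)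
    from cInf_lessD[OF _ this] show ?thesis by blast
  qed
  then obtain x where x: "\<And>n. \<phi> (x n) < I + 1 / real (Suc n)" by metis
  have parallelogram: "(dist u v)\<^sup>2 \<le> 2 * (\<phi> u - I) + 2 * (\<phi> v - I)" for u v
  proof -
    have "\<phi> u + \<phi> v = 2 * \<phi> ((1/2) *\<^sub>R (u + v)) + (dist u v)\<^sup>2 / 2"
      by (simp add: \<phi>_def f.add f.scaleR dist_norm power2_norm_eq_inner inner_add_left
          inner_add_right inner_diff_left inner_diff_right inner_commute field_simps)
    with I_le[of "(1/2) *\<^sub>R (u + v)"] show ?thesis by simp
  qed
  have "Cauchy x"
  proof (rule metric_CauchyI)
    fix e :: real assume "e > 0"
    then obtain N where N: "1 / real (Suc N) < e\<^sup>2 / 4"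
      using nat_approx_posE[of "e\<^sup>2 / 4"] by auto
    have "dist (x m) (x n) < e" if "m \<ge> N" "n \<ge> N" for m n
    proof -
      have small: "\<phi> (x k) - I < e\<^sup>2 / 4" if "k \<ge> N" for k
      proof -
        have "1 / real (Suc k) \<le> 1 / real (Suc N)" using that by (simp add: frac_le)
        with x[of k] N show ?thesis by linarith
      qed
      have "(dist (x m) (x n))\<^sup>2 < e\<^sup>2"
        using parallelogram[of "x m" "x n"] small[OF \<open>m \<ge> N\<close>] small[OF \<open>n \<ge> N\<close>] by simp
      then show ?thesis using \<open>e > 0\<close> by (simp add: power2_less_imp_less)
    qed
    then show "\<exists>M. \<forall>m\<ge>M. \<forall>n\<ge>M. dist (x m) (x n) < e" by blast
  qed
  then obtain z where z: "x \<longlonglongrightarrow> z"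
    using Cauchy_convergent convergent_def by blast
  have "(\<lambda>n. \<phi> (x n)) \<longlonglongrightarrow> \<phi> z"
    unfolding \<phi>_def by (intro tendsto_intros f.tendsto z)
  moreover have "(\<lambda>n. I + 1 / real (Suc n)) \<longlonglongrightarrow> I + 0"
    by (intro tendsto_intros LIMSEQ_inverse_real_of_nat[unfolded inverse_eq_divide])
  ultimately have "\<phi> z \<le> I + 0"
    by (rule LIMSEQ_le) (use x less_imp_le in blast)
  then have "\<phi> z \<le> \<phi> w" for w using I_le[of w] by simp
  then have "0 \<le> 2 * t * (z \<bullet> y - f y) + t\<^sup>2 * (y \<bullet> y)" for t y
    using expand[of z t y] by (metis add.assoc add_le_cancel_left add.right_neutral)
  then have "z \<bullet> y - f y = 0" for y by (rule linear_coefficient_zero)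
  then show thesis by (intro that[of z]) (simp add: inner_commute)
qed

text \<open>An adjoint is automatically linear, since it is determined by its inner products, and
  it is bounded because \<open>\<parallel>Y y\<parallel>\<^sup>2 = \<langle>X (Y y), y\<rangle>\<close>.\<close>
lemma bounded_linear_adjoint:
  fixes X Y :: "'a::real_inner \<Rightarrow> 'a"
  assumes "bounded_linear X" and adj: "\<And>x y. X x \<bullet> y = x \<bullet> Y y"
  shows "bounded_linear Y"
proof -
  interpret X: bounded_linear X by fact
  obtain K where K: "\<And>x. norm (X x) \<le> norm x * K" using X.bounded by auto
  show ?thesis
  proof (rule bounded_linear_intro)
    show "Y (x + y) = Y x + Y y" for x y
      by (rule vector_eq_ldot[THEN iffD1]) (simp add: adj[symmetric] inner_add_right)
    show "Y (r *\<^sub>R x) = r *\<^sub>R Y x" for r x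
      by (rule vector_eq_ldot[THEN iffD1]) (simp add: adj[symmetric])
    show "norm (Y y) \<le> norm y * K" for y
    proof (cases "Y y = 0")
      case True
      have "0 \<le> norm (X y)" by simp
      also have "\<dots> \<le> norm y * K" by (rule K)
      finally show ?thesis using True by simp
    next
      case False
      have "norm (Y y) * norm (Y y) = X (Y y) \<bullet> y"
        by (simp add: adj dot_square_norm power2_eq_square)
      also have "\<dots> \<le> norm (X (Y y)) * norm y" by (rule norm_cauchy_schwarz)
      also have "\<dots> \<le> (norm (Y y) * K) * norm y" by (intro mult_right_mono K) simp
      finally have "norm (Y y) * norm (Y y) \<le> norm (Y y) * (norm y * K)"
        by (simp add: ac_simps)
      then show ?thesis using False by simp
    qed
  qed
qed

lemma adjoint_exists:
  fixes X :: "'a::{real_inner,banach} \<Rightarrow> 'a"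
  assumes "bounded_linear X"
  obtains Y where "\<And>x y. X x \<bullet> y = x \<bullet> Y y"
proof -
  have "\<exists>z. \<forall>x. X x \<bullet> y = x \<bullet> z" for y
    using riesz_representation[OF bounded_linear_inner_left_comp[OF assms, of y]] by metis
  then show thesis using that by metis
qed

section \<open>Positive square roots\<close>

text \<open>The square root of \<open>I - N\<close> with \<open>\<parallel>N\<parallel> \<le> 1\<close> is sought as \<open>I - Y\<close>, which requires
  \<open>Y = (N + Y\<^sup>2) / 2\<close>. This equation is iterated from \<open>0\<close>. The iteration need not contract, as
  \<open>\<parallel>N\<parallel> = 1\<close> is allowed; instead its increments are dominated by those of the same iteration for the
  number \<open>1\<close> in place of \<open>N\<close>, the present sequence, which increases and stays below \<open>1\<close>.\<close>
primrec sqrt_majorant :: "nat \<Rightarrow> real" where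
  "sqrt_majorant 0 = 0"
| "sqrt_majorant (Suc n) = (1 + (sqrt_majorant n)\<^sup>2) / 2"

lemma sqrt_majorant_bounds: "0 \<le> sqrt_majorant n \<and> sqrt_majorant n \<le> 1"
  by (induction n) (auto simp: power_le_one)

lemma sqrt_majorant_Suc_ge: "sqrt_majorant n \<le> sqrt_majorant (Suc n)"
proof -
  have "0 \<le> (1 - sqrt_majorant n)\<^sup>2" by simp
  then show ?thesis by (simp add: power2_diff)
qed

lemma sqrt_majorant_convergent: "convergent sqrt_majorant"
proof -
  have "incseq sqrt_majorant" by (rule incseq_SucI) (rule sqrt_majorant_Suc_ge)
  moreover have "Bseq sqrt_majorant"
    using sqrt_majorant_bounds by (intro BseqI'[of _ 1]) auto
  ultimately show ?thesis by (intro Bseq_mono_convergent) (auto simp: incseq_def)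
qed

primrec sqrt_iter :: "('a::real_normed_vector \<Rightarrow>\<^sub>L 'a) \<Rightarrow> nat \<Rightarrow> 'a \<Rightarrow>\<^sub>L 'a" where
  "sqrt_iter N 0 = 0"
| "sqrt_iter N (Suc n) = (1/2) *\<^sub>R (N + (sqrt_iter N n o\<^sub>L sqrt_iter N n))"

lemma norm_sqrt_iter:
  assumes "norm N \<le> 1"
  shows "norm (sqrt_iter N n) \<le> sqrt_majorant n"
proof (induction n)
  case (Suc n)
  let ?Y = "sqrt_iter N n"
  have "norm (?Y o\<^sub>L ?Y) \<le> norm ?Y * norm ?Y" by (rule norm_blinfun_compose)
  also have "\<dots> \<le> sqrt_majorant n * sqrt_majorant n" using Suc by (intro mult_mono) (auto simp: sqrt_majorant_bounds)
  finally have "norm (N + (?Y o\<^sub>L ?Y)) \<le> 1 + (sqrt_majorant n)\<^sup>2"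
    using assms by (intro norm_triangle_le) (auto simp: power2_eq_square)
  then show ?case by simp
qed simp

text \<open>Induction based on \<open>Z\<^sup>2 - Y\<^sup>2 = Z (Z - Y) + (Z - Y) Y\<close>, whose norm is at most
  \<open>z (z - y) + (z - y) y = z\<^sup>2 - y\<^sup>2\<close> for the majorants \<open>z\<close> and \<open>y\<close>.\<close>
lemma norm_sqrt_iter_diff:
  assumes "norm N \<le> 1"
  shows "norm (sqrt_iter N (Suc n) - sqrt_iter N n) \<le> sqrt_majorant (Suc n) - sqrt_majorant n"
proof (induction n)
  case 0
  then show ?case using assms by simp
next
  case (Suc n)
  let ?Y = "sqrt_iter N n" and ?Z = "sqrt_iter N (Suc n)"
  let ?y = "sqrt_majorant n" and ?z = "sqrt_majorant (Suc n)"
  have YZ: "norm ?Y \<le> ?y" "norm ?Z \<le> ?z" by (rule norm_sqrt_iter[OF assms])+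
  have split: "sqrt_iter N (Suc (Suc n)) - ?Z =
      (1/2) *\<^sub>R ((?Z o\<^sub>L (?Z - ?Y)) + ((?Z - ?Y) o\<^sub>L ?Y))"
  proof -
    have "sqrt_iter N (Suc (Suc n)) - ?Z = (1/2) *\<^sub>R ((?Z o\<^sub>L ?Z) - (?Y o\<^sub>L ?Y))"
      by (simp only: sqrt_iter.simps(2)[of N "Suc n"] sqrt_iter.simps(2)[of N n, symmetric]
          trans[OF arg_cong2[where f = minus, OF refl sqrt_iter.simps(2)[of N n]]
            scaleR_diff_right[symmetric]] add_diff_cancel_left)
    also have "(?Z o\<^sub>L ?Z) - (?Y o\<^sub>L ?Y) = (?Z o\<^sub>L (?Z - ?Y)) + ((?Z - ?Y) o\<^sub>L ?Y)"
      by (simp only: bounded_bilinear.diff_left[OF bounded_bilinear_blinfun_compose]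
          bounded_bilinear.diff_right[OF bounded_bilinear_blinfun_compose]) simp
    finally show ?thesis .
  qed
  have "norm (?Z o\<^sub>L (?Z - ?Y)) \<le> ?z * (?z - ?y)"
    by (intro order_trans[OF norm_blinfun_compose] mult_mono YZ Suc.IH norm_ge_zero)
      (use sqrt_majorant_bounds in blast)
  moreover have "norm ((?Z - ?Y) o\<^sub>L ?Y) \<le> (?z - ?y) * ?y"
    by (intro order_trans[OF norm_blinfun_compose] mult_mono YZ Suc.IH norm_ge_zero)
      (use sqrt_majorant_Suc_ge[of n] in simp)
  ultimately have "norm (sqrt_iter N (Suc (Suc n)) - ?Z) \<le> (?z * (?z - ?y) + (?z - ?y) * ?y) / 2"
    unfolding split using norm_triangle_ineq[of "?Z o\<^sub>L (?Z - ?Y)" "(?Z - ?Y) o\<^sub>L ?Y"] by simp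
  also have "\<dots> = (?z\<^sup>2 - ?y\<^sup>2) / 2" by (simp add: power2_eq_square algebra_simps)
  also have "\<dots> = sqrt_majorant (Suc (Suc n)) - ?z"
    by (simp add: field_simps)
  finally show ?case .
qed

lemma sqrt_iter_convergent:
  fixes N :: "'a::banach \<Rightarrow>\<^sub>L 'a"
  assumes "norm N \<le> 1"
  shows "convergent (sqrt_iter N)"
proof -
  obtain l where "sqrt_majorant \<longlonglongrightarrow> l"
    using sqrt_majorant_convergent convergent_def by blast
  then have "summable (\<lambda>n. sqrt_majorant (Suc n) - sqrt_majorant n)"
    by (rule telescope_summable)
  then have "summable (\<lambda>n. sqrt_iter N (Suc n) - sqrt_iter N n)"
    by (rule summable_comparison_test') (rule norm_sqrt_iter_diff[OF assms])
  then have "convergent (\<lambda>n. \<Sum>k<n. sqrt_iter N (Suc k) - sqrt_iter N k)"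
    by (simp add: summable_iff_convergent)
  then show ?thesis by (simp only: sum_lessThan_telescope) simp
qed

text \<open>The iterates are polynomials in \<open>N\<close>, so symmetry and commutation with \<open>R\<close> hold for each of them
  and pass to the limit \<open>Y\<close>. Positivity of \<open>I - Y\<close> follows from \<open>\<parallel>Y\<parallel> \<le> 1\<close>. The commutation
  clause is what later yields both uniqueness and complex linearity of the root.\<close>
lemma contraction_sqrt_exists:
  fixes N :: "'a::{real_inner,banach} \<Rightarrow>\<^sub>L 'a"
  assumes "norm N \<le> 1" and sym: "\<And>x y. N x \<bullet> y = x \<bullet> N y"
  obtains S :: "'a \<Rightarrow>\<^sub>L 'a" where "\<And>x y. S x \<bullet> y = x \<bullet> S y" "\<And>x. 0 \<le> S x \<bullet> x"
    "\<And>x. S (S x) = x - N x"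
    "\<And>R x. bounded_linear R \<Longrightarrow> (\<And>x. R (N x) = N (R x)) \<Longrightarrow> R (S x) = S (R x)"
proof -
  obtain Y where Y: "sqrt_iter N \<longlonglongrightarrow> Y"
    using sqrt_iter_convergent[OF assms(1)] convergent_def by blast
  have lim: "(\<lambda>n. sqrt_iter N n x) \<longlonglongrightarrow> Y x" for x
    by (intro tendsto_intros Y)
  have "(\<lambda>n. sqrt_iter N (Suc n)) \<longlonglongrightarrow> Y" using Y by (rule LIMSEQ_Suc)
  moreover have "(\<lambda>n. sqrt_iter N (Suc n)) \<longlonglongrightarrow> (1/2) *\<^sub>R (N + (Y o\<^sub>L Y))"
    unfolding sqrt_iter.simps
    by (intro tendsto_scaleR tendsto_add tendsto_const Y
        bounded_bilinear.tendsto[OF bounded_bilinear_blinfun_compose])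
  ultimately have fix_eq: "Y = (1/2) *\<^sub>R (N + (Y o\<^sub>L Y))" by (rule LIMSEQ_unique)
  have Y_fix: "Y x + Y x = N x + Y (Y x)" for x
  proof -
    have "Y x = (1/2) *\<^sub>R (N x + Y (Y x))"
      using arg_cong[OF fix_eq, of "\<lambda>Z. blinfun_apply Z x"]
      by (simp add: blinfun.add_left blinfun.scaleR_left)
    then show ?thesis by (metis scaleR_half_double scaleR_add_right)
  qed
  have Y_norm: "norm Y \<le> 1"
    by (rule Lim_norm_ubound[OF _ Y])
      (auto intro: eventuallyI order_trans[OF norm_sqrt_iter[OF assms(1)]] sqrt_majorant_bounds[THEN conjunct2])
  have iter_sym: "sqrt_iter N n x \<bullet> y = x \<bullet> sqrt_iter N n y" for n x y
    by (induction n arbitrary: x y)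
      (auto simp: blinfun.add_left blinfun.scaleR_left inner_add_left inner_add_right sym)
  have Y_sym: "Y x \<bullet> y = x \<bullet> Y y" for x y
  proof -
    have "(\<lambda>n. sqrt_iter N n x \<bullet> y) \<longlonglongrightarrow> Y x \<bullet> y" by (intro tendsto_intros Y)
    moreover have "(\<lambda>n. sqrt_iter N n x \<bullet> y) \<longlonglongrightarrow> x \<bullet> Y y"
      unfolding iter_sym by (intro tendsto_intros Y)
    ultimately show ?thesis by (rule LIMSEQ_unique)
  qed
  have Y_commute: "R (Y x) = Y (R x)"
    if R: "bounded_linear R" and RN: "\<And>x. R (N x) = N (R x)" for R x
  proof -
    interpret R: bounded_linear R by fact
    have iter_commute: "R (sqrt_iter N n x) = sqrt_iter N n (R x)" for n x
      by (induction n arbitrary: x)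
        (auto simp: blinfun.add_left blinfun.scaleR_left R.add R.scaleR RN R.zero)
    have "(\<lambda>n. R (sqrt_iter N n x)) \<longlonglongrightarrow> R (Y x)" by (intro R.tendsto lim)
    moreover have "(\<lambda>n. R (sqrt_iter N n x)) \<longlonglongrightarrow> Y (R x)"
      unfolding iter_commute by (rule lim)
    ultimately show ?thesis by (rule LIMSEQ_unique)
  qed
  define S where "S = id_blinfun - Y"
  have S: "S x = x - Y x" for x by (simp add: S_def blinfun.diff_left)
  show thesis
  proof (rule that[of S])
    show "S x \<bullet> y = x \<bullet> S y" for x y
      by (simp add: S inner_diff_left inner_diff_right Y_sym)
    show "0 \<le> S x \<bullet> x" for x
    proof -
      have "Y x \<bullet> x \<le> norm (Y x) * norm x" by (rule norm_cauchy_schwarz)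
      also have "norm (Y x) \<le> 1 * norm x"
        using norm_blinfun[of Y x] mult_right_mono[OF Y_norm norm_ge_zero[of x]] by simp
      finally have "Y x \<bullet> x \<le> norm x * norm x" by (simp add: mult_right_mono)
      then show ?thesis by (simp add: S inner_diff_left dot_square_norm power2_eq_square)
    qed
    show "S (S x) = x - N x" for x
      using Y_fix[of x] by (simp add: S blinfun.diff_right algebra_simps)
    show "R (S x) = S (R x)"
      if R: "bounded_linear R" and RN: "\<And>x. R (N x) = N (R x)" for R x
      by (simp add: S bounded_linear.linear[OF R] linear_diff Y_commute[OF R RN])
  qed
qed

text \<open>Rescaling reduces to \<open>P = X\<^sup>* X / M\<^sup>2\<close> with \<open>M\<close> above the norms of \<open>X\<close> and its adjoint. Then
  \<open>\<parallel>P x\<parallel>\<^sup>2 \<le> \<langle>x, P x\<rangle>\<close>, and expanding \<open>\<parallel>x - P x\<parallel>\<^sup>2\<close> shows that \<open>I - P\<close> is a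
  contraction, to which the iteration applies.\<close>
lemma sqrt_adjoint_mult_exists:
  fixes X Y :: "'a::{real_inner,banach} \<Rightarrow> 'a"
  assumes X: "bounded_linear X" and adj: "\<And>x y. X x \<bullet> y = x \<bullet> Y y"
  obtains S where "bounded_linear S" "\<And>x y. S x \<bullet> y = x \<bullet> S y" "\<And>x. 0 \<le> S x \<bullet> x"
    "\<And>x. S (S x) = Y (X x)"
    "\<And>R x. bounded_linear R \<Longrightarrow> (\<And>x. R (Y (X x)) = Y (X (R x))) \<Longrightarrow> R (S x) = S (R x)"
proof -
  have Y: "bounded_linear Y" by (rule bounded_linear_adjoint[OF X adj])
  have adj': "Y x \<bullet> y = x \<bullet> X y" for x y by (metis adj inner_commute)
  define M where "M = max 1 (max (onorm X) (onorm Y))"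
  have M: "M > 0" "onorm X \<le> M" "onorm Y \<le> M" unfolding M_def by auto
  have MY: "norm (Y x) \<le> M * norm x" for x
    using onorm[OF Y, of x] mult_right_mono[OF M(3) norm_ge_zero[of x]] by linarith
  define P where "P x = (1 / M\<^sup>2) *\<^sub>R Y (X x)" for x
  have P: "bounded_linear P"
    unfolding P_def by (intro bounded_linear_intros bounded_linear_compose[OF Y X])
  define N where "N = Blinfun (\<lambda>x. x - P x)"
  have N: "N x = x - P x" for x
    unfolding N_def by (simp add: bounded_linear_Blinfun_apply bounded_linear_sub P bounded_linear_ident)
  have N_contraction: "norm N \<le> 1"
  proof (rule norm_blinfun_bound)
    fix x
    have "(norm (P x))\<^sup>2 = (norm (Y (X x)))\<^sup>2 / M^4"
      using M by (simp add: P_def power_divide power_mult[symmetric])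
    also have "\<dots> \<le> (M * norm (X x))\<^sup>2 / M^4"
      using M by (intro divide_right_mono power_mono MY) auto
    also have "\<dots> = (norm (X x))\<^sup>2 / M\<^sup>2"
      using M by (simp add: field_simps power2_eq_square power4_eq_xxxx)
    also have "\<dots> = x \<bullet> P x"
      by (simp add: P_def adj[symmetric] dot_square_norm)
    finally have "(norm (P x))\<^sup>2 \<le> x \<bullet> P x" .
    moreover have "0 \<le> (norm (P x))\<^sup>2" by simp
    moreover have "(norm (x - P x))\<^sup>2 = (norm x)\<^sup>2 - 2 * (x \<bullet> P x) + (norm (P x))\<^sup>2"
      by (simp add: power2_norm_eq_inner inner_diff_left inner_diff_right inner_commute)
    ultimately have "(norm (x - P x))\<^sup>2 \<le> (norm x)\<^sup>2" by linarith
    then show "norm (N x) \<le> 1 * norm x" unfolding N by (simp only: power2_le_imp_le norm_ge_zero mult_1)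
  qed simp
  have N_sym: "N x \<bullet> y = x \<bullet> N y" for x y
    by (simp add: N P_def inner_diff_left inner_diff_right adj adj')
  show thesis
  proof (rule contraction_sqrt_exists[OF N_contraction N_sym], rule that)
    fix S :: "'a \<Rightarrow>\<^sub>L 'a"
    assume S: "\<And>x y. S x \<bullet> y = x \<bullet> S y" "\<And>x. 0 \<le> S x \<bullet> x" "\<And>x. S (S x) = x - N x"
      "\<And>R x. bounded_linear R \<Longrightarrow> (\<And>x. R (N x) = N (R x)) \<Longrightarrow> R (S x) = S (R x)"
    show "bounded_linear (\<lambda>x. M *\<^sub>R S x)"
      by (intro bounded_linear_intros)
    show "(M *\<^sub>R S x) \<bullet> y = x \<bullet> (M *\<^sub>R S y)" for x y by (simp add: S)
    show "0 \<le> (M *\<^sub>R S x) \<bullet> x" for x using M S(2) by simp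
    show "M *\<^sub>R S (M *\<^sub>R S x) = Y (X x)" for x
      using M by (simp add: blinfun.scaleR_right S(3) N P_def power2_eq_square)
    show "R (M *\<^sub>R S x) = M *\<^sub>R S (R x)"
      if R: "bounded_linear R" and RP: "\<And>x. R (Y (X x)) = Y (X (R x))" for R x
    proof -
      interpret R: bounded_linear R by fact
      have "R (N x) = N (R x)" for x by (simp add: N P_def R.diff R.scaleR RP)
      then show ?thesis by (simp add: R.scaleR S(4)[OF R])
    qed
  qed
qed

text \<open>The form \<open>\<langle>S z, z\<rangle>\<close> is minimal at \<open>z = y\<close>; the first-order condition in the direction
  \<open>S y\<close> gives \<open>\<parallel>S y\<parallel>\<^sup>2 = 0\<close>.\<close>
lemma positive_kernel:
  fixes S :: "'a::real_inner \<Rightarrow> 'a"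
  assumes S: "bounded_linear S" and sym: "\<And>x y. S x \<bullet> y = x \<bullet> S y"
    and pos: "\<And>x. 0 \<le> S x \<bullet> x" and "S y \<bullet> y = 0"
  shows "S y = 0"
proof -
  interpret S: bounded_linear S by fact
  have "0 \<le> 2 * t * (S y \<bullet> S y) + t\<^sup>2 * (S (S y) \<bullet> S y)" for t
    using pos[of "y + t *\<^sub>R S y"] \<open>S y \<bullet> y = 0\<close> sym[of "S y" y]
    by (simp add: S.add S.scaleR inner_add_left inner_add_right power2_eq_square algebra_simps)
  then have "S y \<bullet> S y = 0" by (rule linear_coefficient_zero)
  then show ?thesis by simp
qed

text \<open>By commutativity \<open>(R + S) (R - S) = R\<^sup>2 - S\<^sup>2 = 0\<close>. So for \<open>y = (R - S) x\<close> the nonnegative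
  numbers \<open>\<langle>R y, y\<rangle>\<close> and \<open>\<langle>S y, y\<rangle>\<close> add up to \<open>0\<close>, which puts \<open>y\<close> in both kernels, and then
  \<open>\<parallel>y\<parallel>\<^sup>2 = \<langle>x, (R - S) y\<rangle> = 0\<close>.\<close>
lemma commuting_sqrt_unique:
  fixes S R :: "'a::real_inner \<Rightarrow> 'a"
  assumes S: "bounded_linear S" "\<And>x y. S x \<bullet> y = x \<bullet> S y" "\<And>x. 0 \<le> S x \<bullet> x"
    and R: "bounded_linear R" "\<And>x y. R x \<bullet> y = x \<bullet> R y" "\<And>x. 0 \<le> R x \<bullet> x"
    and commute: "\<And>x. R (S x) = S (R x)" and squares: "\<And>x. R (R x) = S (S x)"
  shows "R = S"
proof
  fix x
  interpret S: bounded_linear S by fact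
  interpret R: bounded_linear R by fact
  define y where "y = R x - S x"
  have "R y + S y = 0" by (simp add: y_def R.diff S.diff commute squares)
  then have "R y \<bullet> y + S y \<bullet> y = 0" by (metis inner_add_left inner_zero_left)
  then have "R y \<bullet> y = 0" "S y \<bullet> y = 0" using R(3)[of y] S(3)[of y] by linarith+
  then have "R y = 0" "S y = 0" using positive_kernel[OF R] positive_kernel[OF S] by blast+
  then have "y \<bullet> y = 0"
    using R(2)[of x y] S(2)[of x y] by (simp add: y_def inner_diff_left)
  then show "R x = S x" by (simp add: y_def)
qed

section \<open>Complex structure\<close>

text \<open>This makes the operators on a complex Hilbert space a Banach space, where the iteration for
  the square root converges, and gives access to the real results above.\<close>
instance complex_hilbert \<subseteq> banach ..

lemma scaleC_minus_one: "(-1) *\<^sub>C x = - (x::'a::complex_inner)"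
  using scaleR_scaleC[of "-1" x] by simp

lemma scaleC_minus_right: "c *\<^sub>C (- x) = - (c *\<^sub>C (x::'a::complex_inner))"
  by (metis scaleC_minus_one scaleC_scaleC mult.commute)

lemma scaleC_minus_left: "(- c) *\<^sub>C x = - (c *\<^sub>C (x::'a::complex_inner))"
  by (metis scaleC_minus_one scaleC_scaleC mult_minus1)

lemma scaleC_diff_right: "c *\<^sub>C (x - y) = c *\<^sub>C x - c *\<^sub>C (y::'a::complex_inner)"
  by (metis scaleC_add_right scaleC_minus_right diff_conv_add_uminus)

lemma scaleC_i_i: "\<i> *\<^sub>C \<i> *\<^sub>C x = - (x::'a::complex_inner)"
  by (simp add: scaleC_scaleC scaleC_minus_one)

lemma cinner_scaleC_right: "\<langle>x, c *\<^sub>C y\<rangle> = cnj c * \<langle>x, y\<rangle>"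
  by (metis cinner_commute cinner_scaleC_left complex_cnj_mult)

lemma inner_i_left: "(\<i> *\<^sub>C x) \<bullet> y = - (x \<bullet> (\<i> *\<^sub>C (y::'a::complex_inner)))"
  by (simp add: inner_eq_Re_cinner cinner_scaleC_left cinner_scaleC_right)

lemma Im_cinner: "Im \<langle>x, y\<rangle> = - ((\<i> *\<^sub>C x) \<bullet> (y::'a::complex_inner))"
  by (simp add: inner_eq_Re_cinner cinner_scaleC_left)

lemma scaleC_decompose: "c *\<^sub>C x = Re c *\<^sub>R x + Im c *\<^sub>R \<i> *\<^sub>C (x::'a::complex_inner)"
proof -
  have "c = complex_of_real (Re c) + complex_of_real (Im c) * \<i>"
    using complex_eq[of c] by (simp add: mult.commute)
  then show ?thesis by (metis scaleR_scaleC scaleC_scaleC scaleC_add_left)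
qed

lemma bounded_linear_scaleC: "bounded_linear (\<lambda>x::'a::complex_inner. c *\<^sub>C x)"
proof (rule bounded_linear_intro)
  show "c *\<^sub>C (x + y) = c *\<^sub>C x + c *\<^sub>C y" for x y :: 'a by (rule scaleC_add_right)
  show "c *\<^sub>C (r *\<^sub>R x) = r *\<^sub>R (c *\<^sub>C x)" for r and x :: 'a
    by (simp add: scaleR_scaleC scaleC_scaleC mult.commute)
  show "norm (c *\<^sub>C x) \<le> norm x * cmod c" for x :: 'a
  proof (rule power2_le_imp_le)
    have "\<langle>c *\<^sub>C x, c *\<^sub>C x\<rangle> = complex_of_real ((cmod c)\<^sup>2) * \<langle>x, x\<rangle>"
      by (simp add: cinner_scaleC_left cinner_scaleC_right complex_norm_square ac_simps del: of_real_power)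
    then show "(norm (c *\<^sub>C x))\<^sup>2 \<le> (norm x * cmod c)\<^sup>2"
      by (simp add: power2_norm_eq_inner inner_eq_Re_cinner power_mult_distrib mult.commute)
  qed simp
qed

lemma bounded_clinear_iff:
  "bounded_clinear X \<longleftrightarrow> bounded_linear X \<and> (\<forall>x. X (\<i> *\<^sub>C x) = \<i> *\<^sub>C X x)"
  unfolding bounded_clinear_def
proof (intro conj_cong refl iffI allI)
  fix c x
  assume X: "bounded_linear X" and i: "\<forall>x. X (\<i> *\<^sub>C x) = \<i> *\<^sub>C X x"
  show "X (c *\<^sub>C x) = c *\<^sub>C X x"
    using i by (simp add: scaleC_decompose[of c] bounded_linear.linear[OF X] linear_add linear_scale)
qed auto

text \<open>Since \<open>Im \<langle>u, v\<rangle> = - Re \<langle>i u, v\<rangle>\<close>, for a complex linear operator the real adjoint is also the complex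
  one.\<close>
lemma cinner_adjointI:
  fixes X Y :: "'a::complex_inner \<Rightarrow> 'a"
  assumes "bounded_clinear X" and adj: "\<And>x y. X x \<bullet> y = x \<bullet> Y y"
  shows "\<langle>X x, y\<rangle> = \<langle>x, Y y\<rangle>"
proof (rule complex_eqI)
  show "Re \<langle>X x, y\<rangle> = Re \<langle>x, Y y\<rangle>"
    using adj by (simp add: inner_eq_Re_cinner)
  have "\<i> *\<^sub>C X x = X (\<i> *\<^sub>C x)" using assms(1) by (simp add: bounded_clinear_iff)
  then show "Im \<langle>X x, y\<rangle> = Im \<langle>x, Y y\<rangle>" by (simp add: Im_cinner adj)
qed

lemma cadjoint_unique:
  fixes X Y :: "'a::complex_inner \<Rightarrow> 'a"
  assumes "\<And>x y. \<langle>X x, y\<rangle> = \<langle>x, Y y\<rangle>"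
  shows "cadjoint X = Y"
  unfolding cadjoint_def
proof (rule the_equality)
  fix Z assume "\<forall>x y. \<langle>X x, y\<rangle> = \<langle>x, Z y\<rangle>"
  then have "x \<bullet> Z y = x \<bullet> Y y" for x y using assms by (simp add: inner_eq_Re_cinner)
  then have "Z y = Y y" for y using vector_eq_ldot[of "Z y" "Y y"] by blast
  then show "Z = Y" by auto
qed (use assms in blast)

lemma cinner_cadjoint:
  fixes X :: "'a::complex_hilbert \<Rightarrow> 'a"
  assumes "bounded_clinear X"
  shows "\<langle>X x, y\<rangle> = \<langle>x, cadjoint X y\<rangle>"
proof -
  obtain Y where "\<And>x y. X x \<bullet> y = x \<bullet> Y y"
    using adjoint_exists assms by (metis bounded_clinear_def)
  then have Y: "\<And>x y. \<langle>X x, y\<rangle> = \<langle>x, Y y\<rangle>" by (rule cinner_adjointI[OF assms])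
  then show ?thesis by (simp add: cadjoint_unique[OF Y])
qed

lemma inner_cadjoint:
  fixes X :: "'a::complex_hilbert \<Rightarrow> 'a"
  assumes "bounded_clinear X"
  shows "X x \<bullet> y = x \<bullet> cadjoint X y"
  using cinner_cadjoint[OF assms] by (simp add: inner_eq_Re_cinner)

lemma bounded_clinear_cadjoint:
  fixes X :: "'a::complex_hilbert \<Rightarrow> 'a"
  assumes "bounded_clinear X"
  shows "bounded_clinear (cadjoint X)"
  unfolding bounded_clinear_iff
proof (intro conjI allI)
  show "bounded_linear (cadjoint X)"
    using assms by (rule bounded_linear_adjoint[OF _ inner_cadjoint, rotated]) (simp add: assms[unfolded bounded_clinear_def])
  fix y
  have "x \<bullet> cadjoint X (\<i> *\<^sub>C y) = x \<bullet> (\<i> *\<^sub>C cadjoint X y)" for x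
  proof -
    have "x \<bullet> cadjoint X (\<i> *\<^sub>C y) = - ((\<i> *\<^sub>C X x) \<bullet> y)"
      by (simp add: inner_cadjoint[OF assms, symmetric] inner_i_left)
    also have "\<i> *\<^sub>C X x = X (\<i> *\<^sub>C x)" using assms by (simp add: bounded_clinear_iff)
    finally show ?thesis by (simp add: inner_cadjoint[OF assms] inner_i_left)
  qed
  then show "cadjoint X (\<i> *\<^sub>C y) = \<i> *\<^sub>C cadjoint X y"
    using vector_eq_ldot[of "cadjoint X (\<i> *\<^sub>C y)"] by blast
qed

lemma cadjoint_cadjoint:
  fixes X :: "'a::complex_hilbert \<Rightarrow> 'a"
  assumes "bounded_clinear X"
  shows "cadjoint (cadjoint X) = X"
proof (rule cadjoint_unique)
  show "\<langle>cadjoint X x, y\<rangle> = \<langle>x, X y\<rangle>" for x y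
    using cinner_cadjoint[OF assms, of y x] cinner_commute[of "cadjoint X x" y] cinner_commute[of x "X y"]
    by simp
qed

text \<open>Polarisation: the form \<open>\<langle>i S x, x\<rangle>\<close> has vanishing real part because \<open>\<langle>S x, x\<rangle>\<close> is real, so its
  symmetrisation vanishes, and replacing \<open>x\<close> by \<open>i x\<close> there gives symmetry of \<open>S\<close>. The
  right-hand side is the notion of positivity used for the real square roots.\<close>
lemma positive_op_iff:
  fixes S :: "'a::complex_inner \<Rightarrow> 'a"
  shows "positive_op S \<longleftrightarrow>
    bounded_clinear S \<and> (\<forall>x y. S x \<bullet> y = x \<bullet> S y) \<and> (\<forall>x. 0 \<le> S x \<bullet> x)"
proof (intro iffI conjI allI)
  assume pos: "positive_op S"
  then show S: "bounded_clinear S" by (simp add: positive_op_def)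
  then interpret S: bounded_linear S by (simp add: bounded_clinear_def)
  have Si: "S (\<i> *\<^sub>C x) = \<i> *\<^sub>C S x" for x using S by (simp add: bounded_clinear_iff)
  show "0 \<le> S x \<bullet> x" for x
    using pos by (auto simp: positive_op_def inner_eq_Re_cinner complex_nonneg_Reals_iff)
  have Im0: "(\<i> *\<^sub>C S x) \<bullet> x = 0" for x
    using pos Im_cinner[of "S x" x] by (auto simp: positive_op_def complex_nonneg_Reals_iff)
  fix x y
  have "(\<i> *\<^sub>C S u) \<bullet> v + (\<i> *\<^sub>C S v) \<bullet> u = 0" for u v
    using Im0[of "u + v"] Im0[of u] Im0[of v]
    by (simp add: S.add scaleC_add_right inner_add_left inner_add_right)
  from this[of "\<i> *\<^sub>C x" y] show "S x \<bullet> y = x \<bullet> S y"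
    by (simp add: Si scaleC_i_i inner_i_left inner_commute)
next
  assume S: "bounded_clinear S \<and> (\<forall>x y. S x \<bullet> y = x \<bullet> S y) \<and> (\<forall>x. 0 \<le> S x \<bullet> x)"
  have "Im \<langle>S x, x\<rangle> = 0" for x
  proof -
    have "\<langle>S x, x\<rangle> = \<langle>x, S x\<rangle>" using S by (intro cinner_adjointI) auto
    then have "\<langle>S x, x\<rangle> = cnj \<langle>S x, x\<rangle>" using cinner_commute by metis
    then show ?thesis by (simp add: complex_eq_iff)
  qed
  then show "positive_op S"
    using S by (auto simp: positive_op_def complex_nonneg_Reals_iff inner_eq_Re_cinner[symmetric])
qed

text \<open>The real square root \<open>S\<close> of \<open>X\<^sup>* X\<close> commutes with every bounded operator that commutes with
  \<open>X\<^sup>* X\<close>. One such operator is multiplication by \<open>i\<close>, so \<open>S\<close> is complex linear; another is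
  any competing root \<open>R\<close>, as \<open>R\<^sup>2 = X\<^sup>* X\<close>, so uniqueness reduces to commuting roots.\<close>
lemma op_abs_ex1:
  fixes X :: "'a::complex_hilbert \<Rightarrow> 'a"
  assumes X: "bounded_clinear X"
  shows "\<exists>!S. positive_op S \<and> S \<circ> S = cadjoint X \<circ> X"
proof -
  have blX: "bounded_linear X" using X by (simp add: bounded_clinear_def)
  obtain S where S: "bounded_linear S" "\<And>x y. S x \<bullet> y = x \<bullet> S y" "\<And>x. 0 \<le> S x \<bullet> x"
    "\<And>x. S (S x) = cadjoint X (X x)"
    "\<And>R x. bounded_linear R \<Longrightarrow> (\<And>x. R (cadjoint X (X x)) = cadjoint X (X (R x))) \<Longrightarrow> R (S x) = S (R x)"
    by (rule sqrt_adjoint_mult_exists[OF blX inner_cadjoint[OF X]]) blast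
  have "\<i> *\<^sub>C S x = S (\<i> *\<^sub>C x)" for x
    using X bounded_clinear_cadjoint[OF X]
    by (intro S(5) bounded_linear_scaleC) (simp add: bounded_clinear_def)
  then have "bounded_clinear S" using S(1) by (simp add: bounded_clinear_iff)
  then have "positive_op S" using S(2,3) by (simp add: positive_op_iff)
  moreover have "S \<circ> S = cadjoint X \<circ> X" using S(4) by auto
  moreover have "R = S" if "positive_op R" and sq: "R \<circ> R = cadjoint X \<circ> X" for R
  proof -
    have RR: "R (R x) = cadjoint X (X x)" for x using fun_cong[OF sq, of x] by simp
    have R: "bounded_linear R" "\<And>x y. R x \<bullet> y = x \<bullet> R y" "\<And>x. 0 \<le> R x \<bullet> x"
      using \<open>positive_op R\<close> by (auto simp: positive_op_iff bounded_clinear_def)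
    have "R (S x) = S (R x)" for x
      by (rule S(5)[OF R(1)]) (simp add: RR[symmetric])
    then show ?thesis by (intro commuting_sqrt_unique S(1-3) R) (simp_all add: RR S(4))
  qed
  ultimately show ?thesis by blast
qed

lemma op_abs:
  fixes X :: "'a::complex_hilbert \<Rightarrow> 'a"
  assumes "bounded_clinear X"
  shows "positive_op (op_abs X)" and "op_abs X (op_abs X x) = cadjoint X (X x)"
proof -
  have *: "positive_op (op_abs X) \<and> op_abs X \<circ> op_abs X = cadjoint X \<circ> X"
    unfolding op_abs_def by (rule theI'[OF op_abs_ex1[OF assms]])
  then show "positive_op (op_abs X)" by blast
  show "op_abs X (op_abs X x) = cadjoint X (X x)"
    using fun_cong[OF conjunct2[OF *], of x] by simp
qed

lemma op_abs_unique:
  fixes X :: "'a::complex_hilbert \<Rightarrow> 'a"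
  assumes "bounded_clinear X" "positive_op S" "\<And>x. S (S x) = cadjoint X (X x)"
  shows "op_abs X = S"
  unfolding op_abs_def
  by (rule the1_equality[OF op_abs_ex1[OF assms(1)]]) (use assms in auto)

section \<open>Conjugations\<close>

context
  fixes C :: "'a::complex_inner \<Rightarrow> 'a"
  assumes C: "conjugation C"
begin

lemma conjugation_add: "C (x + y) = C x + C y"
  and conjugation_scaleC: "C (c *\<^sub>C x) = cnj c *\<^sub>C C x"
  and conjugation_conjugation: "C (C x) = x"
  and cinner_conjugation: "\<langle>C x, C y\<rangle> = \<langle>y, x\<rangle>"
  using C by (auto simp: conjugation_def fun_eq_iff)

lemma conjugation_minus: "C (- x) = - C x"
  using conjugation_scaleC[of "-1" x] by (simp add: scaleC_minus_one)

lemma conjugation_diff: "C (x - y) = C x - C y"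
  using conjugation_add[of x "- y"] by (simp add: conjugation_minus)

lemma norm_conjugation: "norm (C x) = norm x"
  by (simp add: norm_eq_sqrt_inner inner_eq_Re_cinner cinner_conjugation)

lemma bounded_clinear_conjugate:
  assumes "bounded_clinear X"
  shows "bounded_clinear (\<lambda>x. C (X (C x)))"
proof -
  interpret X: bounded_linear X using assms by (simp add: bounded_clinear_def)
  have Xc: "X (c *\<^sub>C x) = c *\<^sub>C X x" for c x using assms by (simp add: bounded_clinear_def)
  obtain K where K: "\<And>x. norm (X x) \<le> norm x * K" using X.bounded by auto
  have "bounded_linear (\<lambda>x. C (X (C x)))"
  proof (rule bounded_linear_intro)
    show "C (X (C (x + y))) = C (X (C x)) + C (X (C y))" for x y
      by (simp add: conjugation_add X.add)
    show "C (X (C (r *\<^sub>R x))) = r *\<^sub>R C (X (C x))" for r x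
      by (simp add: scaleR_scaleC conjugation_scaleC Xc)
    show "norm (C (X (C x))) \<le> norm x * K" for x
      using K[of "C x"] by (simp add: norm_conjugation)
  qed
  then show ?thesis by (simp add: bounded_clinear_def conjugation_scaleC Xc)
qed

lemma positive_op_conjugate:
  assumes "positive_op S"
  shows "positive_op (\<lambda>x. C (S (C x)))"
  unfolding positive_op_def
proof (intro conjI allI)
  show "bounded_clinear (\<lambda>x. C (S (C x)))"
    using assms by (intro bounded_clinear_conjugate) (simp add: positive_op_def)
  fix x
  have "\<langle>C (S (C x)), x\<rangle> = \<langle>C x, S (C x)\<rangle>"
    using cinner_conjugation[of "S (C x)" "C x"] by (simp add: conjugation_conjugation)
  also have "\<dots> = cnj \<langle>S (C x), C x\<rangle>" by (rule cinner_commute)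
  finally show "\<langle>C (S (C x)), x\<rangle> \<in> \<real>\<^sub>\<ge>\<^sub>0"
    using assms by (auto simp: positive_op_def complex_nonneg_Reals_iff)
qed

end

text \<open>Squaring \<open>C |X| C = |X\<^sup>*|\<close> gives \<open>C X\<^sup>* X C = X X\<^sup>*\<close>, because the inner conjugations cancel. Conversely
  \<open>C |X| C\<close> is then a positive square root of \<open>X X\<^sup>*\<close>, hence equal to \<open>|X\<^sup>*|\<close>.\<close>
lemma C_normal_iff:
  fixes X :: "'a::complex_hilbert \<Rightarrow> 'a"
  assumes C: "conjugation C" and X: "bounded_clinear X"
  shows "C_normal C X \<longleftrightarrow> (\<forall>x. C (cadjoint X (X (C x))) = X (cadjoint X x))"
proof
  note X' = bounded_clinear_cadjoint[OF X]
  let ?S = "\<lambda>x. C (op_abs X (C x))"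
  have square: "?S (?S x) = C (cadjoint X (X (C x)))" for x
    by (simp add: conjugation_conjugation[OF C] op_abs(2)[OF X])
  {
    assume "C_normal C X"
    then have abs: "op_abs (cadjoint X) y = ?S y" for y by (auto simp: C_normal_def fun_eq_iff)
    have "?S (?S x) = X (cadjoint X x)" for x
      using op_abs(2)[OF X', of x] by (simp only: abs cadjoint_cadjoint[OF X])
    then show "\<forall>x. C (cadjoint X (X (C x))) = X (cadjoint X x)" by (simp add: square)
  next
    assume "\<forall>x. C (cadjoint X (X (C x))) = X (cadjoint X x)"
    then have "op_abs (cadjoint X) = ?S"
      by (intro op_abs_unique[OF X'] positive_op_conjugate[OF C] op_abs(1)[OF X])
        (simp only: square cadjoint_cadjoint[OF X])
    then show "C_normal C X" by (auto simp: C_normal_def)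
  }
qed

section \<open>Cartesian decompositions relative to a conjugation\<close>

text \<open>The shape in which \<open>C T\<^sup>* T C\<close> and \<open>T T\<^sup>*\<close> are compared: they differ only in the sign of the
  cross term.\<close>
lemma add_i_diff_eq_iff:
  fixes u v w :: "'a::complex_inner"
  shows "w + \<i> *\<^sub>C (u - v) = w + \<i> *\<^sub>C (v - u) \<longleftrightarrow> u = v"
proof
  assume "w + \<i> *\<^sub>C (u - v) = w + \<i> *\<^sub>C (v - u)"
  then have "\<i> *\<^sub>C \<i> *\<^sub>C (u - v) = \<i> *\<^sub>C \<i> *\<^sub>C (v - u)" by simp
  then have "v - u = u - v" by (simp add: scaleC_i_i)
  then have "2 *\<^sub>R (u - v) = (u - v) + (v - u)" by (simp only: scaleR_2)
  then show "u = v" by simp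
qed simp

text \<open>The defect in the Pythagorean identity is \<open>2 Re \<langle>A x, i B x\<rangle>\<close>. Its polarised form is
  \<open>Re \<langle>x, i (A\<^sup>* B - B\<^sup>* A) y\<rangle>\<close>, so the defect vanishes identically exactly when that operator does.\<close>
lemma norm_Pythagoras_iff:
  fixes A B :: "'a::complex_hilbert \<Rightarrow> 'a"
  assumes A: "bounded_clinear A" and B: "bounded_clinear B"
  shows "(\<forall>x. (norm (A x + \<i> *\<^sub>C B x))\<^sup>2 = (norm (A x))\<^sup>2 + (norm (B x))\<^sup>2) \<longleftrightarrow>
    (\<forall>x. cadjoint A (B x) = cadjoint B (A x))"
proof -
  interpret A: bounded_linear A using A by (simp add: bounded_clinear_def)
  interpret B: bounded_linear B using B by (simp add: bounded_clinear_def)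
  let ?A = "cadjoint A" and ?B = "cadjoint B"
  have A': "?A (\<i> *\<^sub>C x) = \<i> *\<^sub>C ?A x" and B': "?B (\<i> *\<^sub>C x) = \<i> *\<^sub>C ?B x" for x
    using bounded_clinear_cadjoint[OF A] bounded_clinear_cadjoint[OF B] by (simp_all add: bounded_clinear_def)
  have cross: "A x \<bullet> (\<i> *\<^sub>C B y) + A y \<bullet> (\<i> *\<^sub>C B x) = x \<bullet> (\<i> *\<^sub>C (?A (B y) - ?B (A y)))" for x y
  proof -
    have "A y \<bullet> (\<i> *\<^sub>C B x) = - (B x \<bullet> (\<i> *\<^sub>C A y))"
      using inner_i_left[of "A y" "B x"] by (simp add: inner_commute)
    then show ?thesis
      by (simp add: inner_cadjoint[OF A] inner_cadjoint[OF B] A' B' scaleC_diff_right inner_diff_right)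
  qed
  have norm_sq: "(norm (A x + \<i> *\<^sub>C B x))\<^sup>2 = (norm (A x))\<^sup>2 + (norm (B x))\<^sup>2 + 2 * (A x \<bullet> (\<i> *\<^sub>C B x))" for x
  proof -
    have "(\<i> *\<^sub>C B x) \<bullet> (\<i> *\<^sub>C B x) = B x \<bullet> B x" by (simp add: inner_i_left scaleC_i_i)
    then show ?thesis
      by (simp add: power2_norm_eq_inner inner_add_left inner_add_right inner_commute)
  qed
  show ?thesis unfolding norm_sq
  proof (intro iffI allI)
    assume "\<forall>x. (norm (A x))\<^sup>2 + (norm (B x))\<^sup>2 + 2 * (A x \<bullet> (\<i> *\<^sub>C B x)) = (norm (A x))\<^sup>2 + (norm (B x))\<^sup>2"
    then have zero: "A x \<bullet> (\<i> *\<^sub>C B x) = 0" for x by simp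
    fix y
    have "x \<bullet> (\<i> *\<^sub>C (?A (B y) - ?B (A y))) = 0" for x
      using zero[of "x + y"] zero[of x] zero[of y] cross[of x y]
      by (simp add: A.add B.add scaleC_add_right inner_add_left inner_add_right)
    then have "\<i> *\<^sub>C (?A (B y) - ?B (A y)) = 0" by (metis inner_eq_zero_iff)
    then have "\<i> *\<^sub>C \<i> *\<^sub>C (?A (B y) - ?B (A y)) = \<i> *\<^sub>C 0" by simp
    then show "?A (B y) = ?B (A y)"
      by (simp add: scaleC_i_i bounded_linear.linear[OF bounded_linear_scaleC] linear_0)
  next
    fix x
    assume "\<forall>x. ?A (B x) = ?B (A x)"
    then show "(norm (A x))\<^sup>2 + (norm (B x))\<^sup>2 + 2 * (A x \<bullet> (\<i> *\<^sub>C B x)) = (norm (A x))\<^sup>2 + (norm (B x))\<^sup>2"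
      using cross[of x x] by (simp add: bounded_linear.linear[OF bounded_linear_scaleC] linear_0)
  qed
qed

lemma onorm_bounds_of_Pythagoras:
  fixes A B T :: "'a::real_normed_vector \<Rightarrow> 'b::real_normed_vector"
  assumes A: "bounded_linear A" and B: "bounded_linear B" and T: "bounded_linear T"
    and pyth: "\<And>x. (norm (T x))\<^sup>2 = (norm (A x))\<^sup>2 + (norm (B x))\<^sup>2"
  shows "max ((onorm A)\<^sup>2) ((onorm B)\<^sup>2) \<le> (onorm T)\<^sup>2"
    and "(onorm T)\<^sup>2 \<le> (onorm A)\<^sup>2 + (onorm B)\<^sup>2"
proof -
  have "norm (A x) \<le> norm (T x)" "norm (B x) \<le> norm (T x)" for x
    by (rule power2_le_imp_le; simp add: pyth)+
  then have "onorm A \<le> onorm T" "onorm B \<le> onorm T"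
    using order_trans[OF _ onorm[OF T]] onorm_pos_le[OF T] by (metis onorm_bound)+
  then show "max ((onorm A)\<^sup>2) ((onorm B)\<^sup>2) \<le> (onorm T)\<^sup>2"
    using onorm_pos_le[OF A] onorm_pos_le[OF B] by (simp add: power_mono)
  let ?k = "sqrt ((onorm A)\<^sup>2 + (onorm B)\<^sup>2)"
  have "norm (T x) \<le> ?k * norm x" for x
  proof (rule power2_le_imp_le)
    have "(norm (T x))\<^sup>2 \<le> (onorm A * norm x)\<^sup>2 + (onorm B * norm x)\<^sup>2"
      unfolding pyth by (intro add_mono power_mono onorm A B norm_ge_zero)
    then show "(norm (T x))\<^sup>2 \<le> (?k * norm x)\<^sup>2"
      by (simp add: power_mult_distrib algebra_simps)
  qed simp
  then have "onorm T \<le> ?k" by (intro onorm_bound) auto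
  then have "(onorm T)\<^sup>2 \<le> ?k\<^sup>2" using onorm_pos_le[OF T] by (intro power_mono)
  then show "(onorm T)\<^sup>2 \<le> (onorm A)\<^sup>2 + (onorm B)\<^sup>2" by simp
qed

theorem theorem5p1:
  fixes C T A B :: "'a::complex_hilbert \<Rightarrow> 'a"
  assumes "separable_space (euclidean :: 'a topology)"
    and "conjugation C"
    and "bounded_clinear T" and "bounded_clinear A" and "bounded_clinear B"
    and "T = (\<lambda>x. A x + \<i> *\<^sub>C B x)"
    and "C_symmetric C A" and "C_skew_symmetric C B"
  shows "(C_normal C T \<longleftrightarrow> (\<forall>x. (norm (T x))\<^sup>2 = (norm (A x))\<^sup>2 + (norm (B x))\<^sup>2)) \<and>
    (C_normal C T \<longleftrightarrow> cadjoint A \<circ> B = cadjoint B \<circ> A) \<and>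
    (C_normal C T \<longleftrightarrow> A \<circ> cadjoint B = B \<circ> cadjoint A) \<and>
    (C_normal C T \<longrightarrow>
      cadjoint T \<circ> T = (\<lambda>x. (cadjoint A \<circ> A) x + (cadjoint B \<circ> B) x) \<and>
      T \<circ> cadjoint T = (\<lambda>x. (A \<circ> cadjoint A) x + (B \<circ> cadjoint B) x) \<and>
      (cadjoint A \<circ> A) \<circ> (cadjoint B \<circ> B) = (cadjoint B \<circ> B) \<circ> (cadjoint A \<circ> A) \<and>
      max ((onorm A)\<^sup>2) ((onorm B)\<^sup>2) \<le> (onorm T)\<^sup>2 \<and>
      (onorm T)\<^sup>2 \<le> (onorm A)\<^sup>2 + (onorm B)\<^sup>2)"
proof -
  note C = assms(2) and T = assms(3) and A = assms(4) and B = assms(5)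
  note C_simps = conjugation_add[OF C] conjugation_scaleC[OF C] conjugation_conjugation[OF C]
    conjugation_minus[OF C] conjugation_diff[OF C]
  let ?A = "cadjoint A" and ?B = "cadjoint B"
  have A': "bounded_clinear ?A" and B': "bounded_clinear ?B"
    using A B by (simp_all add: bounded_clinear_cadjoint)
  interpret A: bounded_linear A using A by (simp add: bounded_clinear_def)
  interpret B: bounded_linear B using B by (simp add: bounded_clinear_def)
  interpret A': bounded_linear ?A using A' by (simp add: bounded_clinear_def)
  interpret B': bounded_linear ?B using B' by (simp add: bounded_clinear_def)
  have scale: "A (c *\<^sub>C x) = c *\<^sub>C A x" "B (c *\<^sub>C x) = c *\<^sub>C B x"
    "?A (c *\<^sub>C x) = c *\<^sub>C ?A x" "?B (c *\<^sub>C x) = c *\<^sub>C ?B x" for c x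
    using A B A' B' by (simp_all add: bounded_clinear_def)
  have Tx: "T x = A x + \<i> *\<^sub>C B x" for x by (simp add: assms(6))
  have CA: "C (A x) = ?A (C x)" for x
    using assms(7) by (auto simp: C_symmetric_def fun_eq_iff) (metis C_simps(3))
  have CA': "C (?A x) = A (C x)" for x by (metis CA C_simps(3))
  have CB': "C (?B x) = - B (C x)" for x
    using assms(8) by (auto simp: C_skew_symmetric_def fun_eq_iff) (metis C_simps(3))
  have CB: "C (B x) = - ?B (C x)" for x
    using CB'[of "C x"] by (metis C_simps(3,4) minus_minus)
  have T': "cadjoint T = (\<lambda>x. ?A x - \<i> *\<^sub>C ?B x)"
  proof (rule cadjoint_unique, rule cinner_adjointI[OF T])
    fix x y
    have "(\<i> *\<^sub>C B x) \<bullet> y = - (x \<bullet> (\<i> *\<^sub>C ?B y))"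
      by (simp add: inner_i_left inner_cadjoint[OF B] scale)
    then show "T x \<bullet> y = x \<bullet> (?A y - \<i> *\<^sub>C ?B y)"
      by (simp add: Tx inner_add_left inner_diff_right inner_cadjoint[OF A])
  qed
  have T'T: "cadjoint T (T x) = ?A (A x) + ?B (B x) + \<i> *\<^sub>C (?A (B x) - ?B (A x))" for x
    by (simp add: T' Tx A'.add B'.add scale scaleC_add_right scaleC_diff_right scaleC_i_i)
  have TT': "T (cadjoint T x) = A (?A x) + B (?B x) + \<i> *\<^sub>C (B (?A x) - A (?B x))" for x
    by (simp add: T' Tx A.diff B.diff scale scaleC_add_right scaleC_diff_right scaleC_i_i)
  have CT'TC: "C (cadjoint T (T (C x))) = A (?A x) + B (?B x) + \<i> *\<^sub>C (A (?B x) - B (?A x))" for x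
    by (simp add: T'T C_simps CA CB CA' CB' A.neg B.neg scaleC_minus_left scaleC_minus_right scaleC_diff_right)
  have normal_iff: "C_normal C T \<longleftrightarrow> A \<circ> ?B = B \<circ> ?A"
    unfolding C_normal_iff[OF C T] CT'TC TT' add_i_diff_eq_iff by (auto simp: fun_eq_iff)
  \<comment> \<open>Conjugation by \<open>C\<close> exchanges the third and the fourth condition up to a common sign.\<close>
  have swap: "C (?A (B (C x))) = - A (?B x)" "C (?B (A (C x))) = - B (?A x)" for x
    by (simp_all add: CA' CB' CA CB A.neg C_simps)
  have "A \<circ> ?B = B \<circ> ?A \<longleftrightarrow> (\<forall>x. ?A (B x) = ?B (A x))"
  proof (intro iffI allI)
    fix x assume "A \<circ> ?B = B \<circ> ?A"
    then have "A (?B (C x)) = B (?A (C x))" by (metis comp_apply)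
    then show "?A (B x) = ?B (A x)" using swap[of "C x"] by (metis C_simps(3))
  next
    assume "\<forall>x. ?A (B x) = ?B (A x)"
    then show "A \<circ> ?B = B \<circ> ?A" using swap by (auto simp: fun_eq_iff)
  qed
  then have iff3: "C_normal C T \<longleftrightarrow> (\<forall>x. ?A (B x) = ?B (A x))" using normal_iff by simp
  have iff2: "C_normal C T \<longleftrightarrow> (\<forall>x. (norm (T x))\<^sup>2 = (norm (A x))\<^sup>2 + (norm (B x))\<^sup>2)"
    unfolding iff3 Tx norm_Pythagoras_iff[OF A B] ..
  have consequences: "cadjoint T \<circ> T = (\<lambda>x. (?A \<circ> A) x + (?B \<circ> B) x) \<and>
      T \<circ> cadjoint T = (\<lambda>x. (A \<circ> ?A) x + (B \<circ> ?B) x) \<and>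
      (?A \<circ> A) \<circ> (?B \<circ> B) = (?B \<circ> B) \<circ> (?A \<circ> A) \<and>
      max ((onorm A)\<^sup>2) ((onorm B)\<^sup>2) \<le> (onorm T)\<^sup>2 \<and>
      (onorm T)\<^sup>2 \<le> (onorm A)\<^sup>2 + (onorm B)\<^sup>2" if normal: "C_normal C T"
  proof (intro conjI)
    have i0: "\<i> *\<^sub>C (0::'a) = 0"
      by (simp add: bounded_linear.linear[OF bounded_linear_scaleC] linear_0)
    have AB: "?A (B x) = ?B (A x)" for x using normal iff3 by blast
    have AB': "A (?B x) = B (?A x)" for x using normal normal_iff by (metis comp_apply)
    show "cadjoint T \<circ> T = (\<lambda>x. (?A \<circ> A) x + (?B \<circ> B) x)"
      by (simp add: fun_eq_iff T'T AB i0)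
    show "T \<circ> cadjoint T = (\<lambda>x. (A \<circ> ?A) x + (B \<circ> ?B) x)"
      by (simp add: fun_eq_iff TT' AB' i0)
    show "(?A \<circ> A) \<circ> (?B \<circ> B) = (?B \<circ> B) \<circ> (?A \<circ> A)"
      by (simp add: fun_eq_iff AB' AB)
    have pyth: "(norm (T x))\<^sup>2 = (norm (A x))\<^sup>2 + (norm (B x))\<^sup>2" for x
      using normal iff2 by blast
    have "bounded_linear T" using T by (simp add: bounded_clinear_def)
    note bounds = onorm_bounds_of_Pythagoras[OF A.bounded_linear_axioms B.bounded_linear_axioms this pyth]
    show "max ((onorm A)\<^sup>2) ((onorm B)\<^sup>2) \<le> (onorm T)\<^sup>2"
      "(onorm T)\<^sup>2 \<le> (onorm A)\<^sup>2 + (onorm B)\<^sup>2" by (fact bounds)+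
  qed
  have "C_normal C T \<longleftrightarrow> ?A \<circ> B = ?B \<circ> A" using iff3 by (auto simp: fun_eq_iff)
  with iff2 normal_iff consequences show ?thesis by blast
qed

end
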